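(* Let $p(\mathbf{x};t)$ be the Gaussian probability density on $\mathbb{R}^n$ with mean $\boldsymbol{\mu}(t)$ and positive definite covariance $\boldsymbol{\Sigma}(t)$, governed by $$\dot{\boldsymbol{\mu}}=\mathbf{A}\boldsymbol{\mu}+\mathbf{B}\mathbf{u}(t),\qquad \dot{\boldsymbol{\Sigma}}=\mathbf{A}\boldsymbol{\Sigma}+\boldsymbol{\Sigma}\mathbf{A}^\top+2\mathbf{D},$$ where $\mathbf{A}\in\mathbb{R}^{n\times n}$, $\mathbf{B}\in\mathbb{R}^{n\times p}$ are constant, $\mathbf{u}(t)\in\mathbb{R}^p$ is continuous, and $\mathbf{D}=\mathbf{D}(t)$ is diagonal with $D_{ii}>0$ for all $i$. Suppose that $\mathbf{A}$ is diagonal and that the random variables $x_1,\dots,x_n$ are independent (so $\boldsymbol{\Sigma}(t)$ is diagonal) at all times. Let $\Gamma$ be the information rate of $p$, and let $\Pi_i$ and $\dot S_i$ be the entropy production and entropy rate from the marginal density $p(x_i,t)$ of $x_i$. Then at every time $t$ $$\Gamma^2=\sum_{i=1}^n\frac{D_{ii}}{\Sigma_{ii}}\,\Pi_i+\sum_{i=1}^n\dot S_i^2.$$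
   Context: The process is the linear Langevin system $\dot x_i=f_i(\mathbf{x};t)+\xi_i(t)$, $i=1,\dots,n$, with $f_i(\mathbf{x};t)=\sum_{j=1}^n a_{ij}x_j+\sum_{j} b_{ij}u_j(t)$, where $\mathbf{A}=(a_{ij})$, $\mathbf{B}=(b_{ij})$, and noise satisfying $\langle\xi_i(t)\rangle=0$, $\langle\xi_i(t)\xi_j(t')\rangle=2D_{ij}\delta(t-t')$. Its density solves the Fokker-Planck equation $\partial_t p=-\sum_i\partial_{x_i}J_i$ with probability current $$J_i(\mathbf{x};t)=f_i(\mathbf{x};t)p(\mathbf{x};t)-\sum_j D_{ij}\,\partial_{x_j}p(\mathbf{x};t).$$ For Gaussian initial data the density is $p(\mathbf{x};t)=\det(2\pi\boldsymbol{\Sigma}(t))^{-1/2}\exp\left(-\tfrac12(\mathbf{x}-\boldsymbol{\mu}(t))^\top\boldsymbol{\Sigma}(t)^{-1}(\mathbf{x}-\boldsymbol{\mu}(t))\right)$ with $\boldsymbol\mu,\boldsymbol\Sigma$ solving the equations in the claim. Definitions (for $\mathbf{D}$ diagonal with positive diagonal entries): - Information rate: $\Gamma(t)=\sqrt{\int_{\mathbb{R}^n}p(\mathbf{x};t)\left[\partial_t\ln p(\mathbf{x};t)\right]^2d^nx}$. - $\Pi_i=\int_{\mathbb{R}^n}\frac{J_i(\mathbf{x};t)^2}{D_{ii}\,p(\mathbf{x};t)}\,d^nx$; for diagonal $\mathbf{A}$ and independent components this is the same as the entropy production of the one-dimensional process $x_i$ computed from its marginal density $p(x_i,t)$. - $\dot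 S_i=-\int_{\mathbb{R}}\partial_t p(x_i,t)\,\ln p(x_i,t)\,dx_i$, the entropy rate of the marginal density $p(x_i,t)$; in this setting it is the same as $\int_{\mathbb{R}^n}\partial_{x_i}J_i(\mathbf{x};t)\,\ln p(\mathbf{x};t)\,d^nx$. *)

theory Defs
  imports "HOL-Probability.Probability"
begin

definition diagonal_matrix :: "real ^ 'n ^ 'n \<Rightarrow> bool" where
  "diagonal_matrix A \<longleftrightarrow> (\<forall>i j. i \<noteq> j \<longrightarrow> A $ i $ j = 0)"

definition pos_def_matrix :: "real ^ 'n ^ 'n \<Rightarrow> bool" where
  "pos_def_matrix S \<longleftrightarrow> transpose S = S \<and> (\<forall>x. x \<noteq> 0 \<longrightarrow> x \<bullet> (S *v x) > 0)"

definition gaussian_density :: "real ^ 'n \<Rightarrow> real ^ 'n ^ 'n \<Rightarrow> real ^ 'n \<Rightarrow> real" where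
  "gaussian_density m S x =
     det ((2 * pi) *\<^sub>R S) powr (- 1 / 2) * exp (- 1 / 2 * ((x - m) \<bullet> (matrix_inv S *v (x - m))))"

text \<open>Time derivatives are taken within the time interval \<open>T\<close>: they are one-sided at an
  endpoint that belongs to \<open>T\<close> and ordinary derivatives in its interior.\<close>

definition time_deriv :: "real set \<Rightarrow> (real \<Rightarrow> real) \<Rightarrow> real \<Rightarrow> real" where
  "time_deriv T g t = vector_derivative g (at t within T)"

definition partial_deriv :: "'n \<Rightarrow> (real ^ 'n \<Rightarrow> real) \<Rightarrow> real ^ 'n \<Rightarrow> real" where
  "partial_deriv j g x = deriv (\<lambda>h. g (x + h *\<^sub>R axis j 1)) 0"

definition drift ::
  "real ^ 'n ^ 'n \<Rightarrow> real ^ 'm ^ 'n \<Rightarrow> (real \<Rightarrow> real ^ 'm) \<Rightarrow> real ^ 'n \<Rightarrow> real \<Rightarrow> real ^ 'n" where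
  "drift A B u x t = A *v x + B *v u t"

definition prob_current ::
  "real ^ 'n ^ 'n \<Rightarrow> real ^ 'm ^ 'n \<Rightarrow> (real \<Rightarrow> real ^ 'm) \<Rightarrow> (real \<Rightarrow> real ^ 'n ^ 'n)
    \<Rightarrow> (real ^ 'n \<Rightarrow> real \<Rightarrow> real) \<Rightarrow> 'n \<Rightarrow> real ^ 'n \<Rightarrow> real \<Rightarrow> real" where
  "prob_current A B u D p i x t =
     drift A B u x t $ i * p x t - (\<Sum>j\<in>UNIV. D t $ i $ j * partial_deriv j (\<lambda>y. p y t) x)"

definition information_rate :: "real set \<Rightarrow> (real ^ 'n \<Rightarrow> real \<Rightarrow> real) \<Rightarrow> real \<Rightarrow> real" where
  "information_rate T p t =
     sqrt (LINT x|lborel. p x t * (time_deriv T (\<lambda>s. ln (p x s)) t)\<^sup>2)"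

definition entropy_production ::
  "real ^ 'n ^ 'n \<Rightarrow> real ^ 'm ^ 'n \<Rightarrow> (real \<Rightarrow> real ^ 'm) \<Rightarrow> (real \<Rightarrow> real ^ 'n ^ 'n)
    \<Rightarrow> (real ^ 'n \<Rightarrow> real \<Rightarrow> real) \<Rightarrow> 'n \<Rightarrow> real \<Rightarrow> real" where
  "entropy_production A B u D p i t =
     (LINT x|lborel. (prob_current A B u D p i x t)\<^sup>2 / (D t $ i $ i * p x t))"

text \<open>The marginal is an integral over all coordinates other than \<open>i\<close>, and not a Radon-Nikodym
  derivative, so that its values and its derivatives make sense pointwise. If \<open>i\<close> is the only
  coordinate, the product measure is the unit mass on a one-point space.\<close>

definition marginal_density :: "(real ^ 'n \<Rightarrow> real \<Rightarrow> real) \<Rightarrow> 'n \<Rightarrow> real \<Rightarrow> real \<Rightarrow> real" where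
  "marginal_density p i y t =
     (LINT z|Pi\<^sub>M (UNIV - {i}) (\<lambda>_. lborel). p (\<chi> j. if j = i then y else z j) t)"

definition marginal_entropy_rate ::
  "real set \<Rightarrow> (real ^ 'n \<Rightarrow> real \<Rightarrow> real) \<Rightarrow> 'n \<Rightarrow> real \<Rightarrow> real" where
  "marginal_entropy_rate T p i t =
     - (LINT y|lborel. time_deriv T (marginal_density p i y) t * ln (marginal_density p i y t))"

text \<open>For diagonal \<open>A\<close> and \<open>D\<close> the component \<open>x\<^sub>i\<close> is itself a one-dimensional linear process,
  with drift \<open>A\<^sub>i\<^sub>i y + (B u(t))\<^sub>i\<close> and diffusion coefficient \<open>D\<^sub>i\<^sub>i\<close>. The next two
  definitions are its current and its entropy production.\<close>

definition marginal_current ::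
  "real ^ 'n ^ 'n \<Rightarrow> real ^ 'm ^ 'n \<Rightarrow> (real \<Rightarrow> real ^ 'm) \<Rightarrow> (real \<Rightarrow> real ^ 'n ^ 'n)
    \<Rightarrow> (real ^ 'n \<Rightarrow> real \<Rightarrow> real) \<Rightarrow> 'n \<Rightarrow> real \<Rightarrow> real \<Rightarrow> real" where
  "marginal_current A B u D p i y t =
     (A $ i $ i * y + (B *v u t) $ i) * marginal_density p i y t
     - D t $ i $ i * deriv (\<lambda>z. marginal_density p i z t) y"

definition marginal_entropy_production ::
  "real ^ 'n ^ 'n \<Rightarrow> real ^ 'm ^ 'n \<Rightarrow> (real \<Rightarrow> real ^ 'm) \<Rightarrow> (real \<Rightarrow> real ^ 'n ^ 'n)
    \<Rightarrow> (real ^ 'n \<Rightarrow> real \<Rightarrow> real) \<Rightarrow> 'n \<Rightarrow> real \<Rightarrow> real" where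
  "marginal_entropy_production A B u D p i t =
     (LINT y|lborel. (marginal_current A B u D p i y t)\<^sup>2
        / (D t $ i $ i * marginal_density p i y t))"

end

theory Submission
  imports Defs
begin

text \<open>Independence makes the probability of a small cube a product over its coordinates, so exchanging
  coordinates between two cubes preserves the product of their probabilities. Shrinking the cubes
  carries this over to the continuous density: \<open>p x * p y = p x' * p y'\<close> when \<open>x'\<close>, \<open>y'\<close> arise from
  \<open>x\<close>, \<open>y\<close> by such an exchange. With \<open>x = \<mu> + e\<^sub>i\<close> and \<open>y = \<mu> + e\<^sub>j\<close> this annihilates the
  off-diagonal entries of \<open>\<Sigma>\<inverse>\<close>, so \<open>p\<close> is a product of one-dimensional normal densities with variances
  \<open>v\<^sub>i = \<Sigma>\<^sub>i\<^sub>i\<close>. The time derivative of \<open>ln p\<close> is then a sum of centred, hence orthogonal, quadratic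
  scores, and normal moments give \<open>\<Gamma>\<^sup>2 = \<Sum>\<^sub>i v'\<^sub>i\<^sup>2 / (2 v\<^sub>i\<^sup>2) + \<mu>'\<^sub>i\<^sup>2 / v\<^sub>i\<close>,
  \<open>D\<^sub>i\<^sub>i \<Pi>\<^sub>i = v'\<^sub>i\<^sup>2 / (4 v\<^sub>i) + \<mu>'\<^sub>i\<^sup>2\<close>, and \<open>v'\<^sub>i / (2 v\<^sub>i)\<close> for the entropy rate of the \<open>i\<close>-th marginal.\<close>

section \<open>Independence and the covariance matrix\<close>

abbreviation cube :: "real ^ 'n \<Rightarrow> real \<Rightarrow> (real ^ 'n) set" where
  "cube c h \<equiv> cbox (\<chi> i. c $ i - h) (\<chi> i. c $ i + h)"

lemma content_cube:
  fixes c :: "real ^ 'n"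
  assumes "h > 0"
  shows "measure lborel (cube c h) = (2 * h) ^ CARD('n)"
proof -
  have "cube c h \<noteq> {}" using assms by (auto simp: interval_eq_empty_cart not_less)
  then show ?thesis by (subst content_cbox_cart) (auto simp: algebra_simps)
qed

text \<open>Continuity makes this elementary: on a small enough cube \<open>f\<close> stays within
  \<open>e / 2\<close> of \<open>f c\<close>, so its integral differs from \<open>f c\<close> times
  the volume by at most \<open>e / 2\<close> times the volume.\<close>

lemma cube_average_tendsto:
  fixes f :: "real ^ 'n \<Rightarrow> real"
  assumes f: "continuous_on UNIV f"
  shows "((\<lambda>h. (LINT x|lborel. f x * indicator (cube c h) x) / (2 * h) ^ CARD('n)) \<longlongrightarrow> f c) (at_right 0)"
proof (rule tendstoI)
  fix e :: real assume e: "e > 0"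
  have "isCont f c" using f by (simp add: continuous_on_eq_continuous_at)
  then obtain d where d: "d > 0" "\<And>x. dist x c < d \<Longrightarrow> dist (f x) (f c) < e / 2"
    using e unfolding continuous_at_eps_delta by (metis half_gt_zero dist_commute)
  \<comment> \<open>The norm is bounded by the sum of the coordinate deviations, each at most
    \<open>h\<close>; dividing by the dimension keeps the cube inside the ball of radius
    \<open>d\<close>.\<close>
  define r where "r = d / real CARD('n)"
  have r: "r > 0" using d by (simp add: r_def)
  have "dist ((LINT x|lborel. f x * indicator (cube c h) x) / (2 * h) ^ CARD('n)) (f c) < e"
    if h: "h > 0" "h < r" for h
  proof -
    have vol: "(2 * h) ^ CARD('n) > 0" using h by simp
    have close: "norm (f x - f c) \<le> e / 2" if x: "x \<in> cube c h" for x
    proof -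
      have "norm (x - c) \<le> (\<Sum>i\<in>UNIV. \<bar>(x - c) $ i\<bar>)" by (rule norm_le_l1_cart)
      also have "\<dots> \<le> (\<Sum>i\<in>(UNIV::'n set). h)"
        using x by (intro sum_mono) (auto simp: mem_box_cart abs_le_iff algebra_simps)
      also have "\<dots> < d" using h by (simp add: r_def field_simps)
      finally show ?thesis using d(2)[of x] by (simp add: dist_norm)
    qed
    have I: "set_integrable lborel (cube c h) f"
      unfolding set_integrable_def by (intro borel_integrable_compact) (auto intro: continuous_on_subset[OF f])
    have "(LINT x|lborel. f x * indicator (cube c h) x) = integral (cube c h) f"
      using set_borel_integral_eq_integral(2)[OF I]
      by (simp add: set_lebesgue_integral_def mult.commute)
    moreover have "((\<lambda>x. f x - f c) has_integral (integral (cube c h) f - f c * (2 * h) ^ CARD('n))) (cube c h)"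
      using has_integral_diff[OF integrable_integral[OF set_borel_integral_eq_integral(1)[OF I]]
          has_integral_const[of "f c" "\<chi> i. c $ i - h" "\<chi> i. c $ i + h"]]
      unfolding content_cube[OF h(1)] by (simp add: mult.commute)
    then have "norm (integral (cube c h) f - f c * (2 * h) ^ CARD('n)) \<le> e / 2 * measure lborel (cube c h)"
      by (rule has_integral_bound[rotated]) (use e close in auto)
    ultimately have b: "\<bar>(LINT x|lborel. f x * indicator (cube c h) x) - f c * (2 * h) ^ CARD('n)\<bar>
        \<le> e / 2 * (2 * h) ^ CARD('n)"
      unfolding content_cube[OF h(1)] by simp
    have "\<bar>(LINT x|lborel. f x * indicator (cube c h) x) / (2 * h) ^ CARD('n) - f c\<bar>
        = \<bar>(LINT x|lborel. f x * indicator (cube c h) x) - f c * (2 * h) ^ CARD('n)\<bar> / (2 * h) ^ CARD('n)"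
      using vol h(1) by (simp add: diff_divide_distrib abs_div_pos)
    also have "\<dots> \<le> e / 2" using b vol by (simp add: divide_le_eq)
    finally show ?thesis using e by (simp add: dist_real_def)
  qed
  then show "\<forall>\<^sub>F h in at_right 0. dist ((LINT x|lborel. f x * indicator (cube c h) x) / (2 * h) ^ CARD('n)) (f c) < e"
    unfolding eventually_at_right_field using r by blast
qed

text \<open>A density is fixed only up to null sets, so the pointwise identity is recovered from
  cube probabilities through continuity. The exchange form replaces a factorisation and so avoids
  marginal densities.\<close>

lemma indep_density_exchange:
  fixes p :: "real ^ 'n \<Rightarrow> real" and X :: "'w \<Rightarrow> real ^ 'n"
  assumes M: "prob_space M"
    and X: "distributed M lborel X (\<lambda>x. ennreal (p x))"
    and indep: "prob_space.indep_vars M (\<lambda>_. borel) (\<lambda>i \<omega>. X \<omega> $ i) UNIV"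
    and cont: "continuous_on UNIV p" and nonneg: "\<And>x. p x \<ge> 0"
    and swap: "\<And>k. x' $ k = x $ k \<and> y' $ k = y $ k \<or> x' $ k = y $ k \<and> y' $ k = x $ k"
  shows "p x * p y = p x' * p y'"
proof -
  interpret prob_space M by fact
  define q where "q h c = (LINT x|lborel. p x * indicator (cube c h) x)" for h c
  define P where "P h a k = prob ((\<lambda>\<omega>. X \<omega> $ k) -` {a - h..a + h} \<inter> space M)" for h a k
  have q: "q h c = (\<Prod>k\<in>UNIV. P h (c $ k) k)" for h c
  proof -
    have Xm: "X \<in> borel_measurable M" using distributed_measurable[OF X] by simp
    have "q h c = (LINT \<omega>|M. indicator (cube c h) (X \<omega>))"
      unfolding q_def by (rule distributed_integral[OF X]) (use nonneg in auto)
    also have "\<dots> = (LINT \<omega>|M. indicator (X -` cube c h \<inter> space M) \<omega>)"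
      by (intro Bochner_Integration.integral_cong) (auto simp: indicator_def)
    also have "\<dots> = prob (X -` cube c h \<inter> space M)"
      using Xm by simp
    also have "X -` cube c h \<inter> space M
        = (\<Inter>k\<in>UNIV. (\<lambda>\<omega>. X \<omega> $ k) -` {c $ k - h..c $ k + h} \<inter> space M)"
      by (auto simp: mem_box_cart)
    also have "prob \<dots> = (\<Prod>k\<in>UNIV. P h (c $ k) k)"
      unfolding P_def by (rule indep_varsD_finite[OF indep]) auto
    finally show ?thesis .
  qed
  \<comment> \<open>In each coordinate the two factors either stay or trade places, so their product
    is the same.\<close>
  have eq: "q h x * q h y = q h x' * q h y'" for h
    unfolding q prod.distrib[symmetric]
  proof (rule prod.cong)
    fix k show "P h (x $ k) k * P h (y $ k) k = P h (x' $ k) k * P h (y' $ k) k"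
      using swap[of k] by auto
  qed simp
  \<comment> \<open>Every cube of half-width \<open>h\<close> has the same volume, so
    \<open>eq\<close> survives normalisation and uniqueness of limits applies.\<close>
  note lim = cube_average_tendsto[OF cont, folded q_def]
  have "((\<lambda>h. q h x / (2 * h) ^ CARD('n) * (q h y / (2 * h) ^ CARD('n))) \<longlongrightarrow> p x * p y) (at_right 0)"
    by (intro tendsto_mult lim)
  moreover have "((\<lambda>h. q h x' / (2 * h) ^ CARD('n) * (q h y' / (2 * h) ^ CARD('n))) \<longlongrightarrow> p x' * p y') (at_right 0)"
    by (intro tendsto_mult lim)
  ultimately show ?thesis
    by (intro tendsto_unique[of "at_right (0::real)"]) (auto simp: eq)
qed

section \<open>Diagonal and positive definite matrices\<close>

lemma diagonal_matrix_row_sum: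
  fixes A :: "real ^ 'n ^ 'n"
  assumes "diagonal_matrix A"
  shows "(\<Sum>j\<in>UNIV. A $ i $ j * f j) = A $ i $ i * f i"
proof -
  have "(\<Sum>j\<in>UNIV. A $ i $ j * f j) = (\<Sum>j\<in>UNIV. if j = i then A $ i $ j * f j else 0)"
    using assms by (intro sum.cong) (auto simp: diagonal_matrix_def)
  then show ?thesis by simp
qed

text \<open>The kernel of \<open>S\<close> is trivial, and in finite dimension an injective square
  matrix has a two-sided inverse. \<open>matrix_inv\<close> is a choice, hence
  \<open>someI_ex\<close>.\<close>

lemma pos_def_matrix_inv:
  fixes S :: "real ^ 'n ^ 'n"
  assumes "pos_def_matrix S"
  shows "S ** matrix_inv S = mat 1" "matrix_inv S ** S = mat 1"
proof -
  have "x = 0" if "S *v x = 0" for x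
    using assms that unfolding pos_def_matrix_def by (metis inner_zero_right less_irrefl)
  then have "inj ((*v) S)"
    by (metis matrix_left_invertible_injective matrix_left_invertible_ker)
  then have "invertible S"
    using matrix_left_invertible_injective[of S] matrix_left_right_inverse[of _ S]
    unfolding invertible_def by blast
  then have "S ** matrix_inv S = mat 1 \<and> matrix_inv S ** S = mat 1"
    unfolding invertible_def matrix_inv_def by (rule someI_ex)
  then show "S ** matrix_inv S = mat 1" "matrix_inv S ** S = mat 1" by auto
qed

text \<open>Transposing \<open>S ** ?K = mat 1\<close> turns the right inverse into a left inverse,
  and the two coincide.\<close>

lemma transpose_matrix_inv:
  fixes S :: "real ^ 'n ^ 'n"
  assumes "pos_def_matrix S"
  shows "transpose (matrix_inv S) = matrix_inv S"
proof -
  let ?K = "matrix_inv S"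
  note inv = pos_def_matrix_inv[OF assms]
  have "transpose S = S" using assms by (simp add: pos_def_matrix_def)
  then have "transpose ?K ** S = mat 1"
    by (metis inv(1) matrix_transpose_mul transpose_mat)
  then show ?thesis
    by (metis inv(1) matrix_mul_assoc matrix_mul_lid matrix_mul_rid)
qed

lemma pos_def_matrix_diag_pos:
  fixes S :: "real ^ 'n ^ 'n"
  assumes "pos_def_matrix S"
  shows "S $ i $ i > 0"
proof -
  have "axis i 1 \<bullet> (S *v axis i 1) > 0"
    using assms by (auto simp: pos_def_matrix_def axis_eq_0_iff)
  then show ?thesis
    by (simp add: inner_axis' matrix_vector_mult_basis column_def)
qed

text \<open>The value of \<open>powr\<close> is zero at base zero and positive elsewhere, so only a
  vanishing determinant could fail; it would make the density identically zero, contradicting total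
  mass one.\<close>

lemma gaussian_density_pos:
  fixes S :: "real ^ 'n ^ 'n"
  assumes "distributed M lborel X (\<lambda>x. ennreal (gaussian_density m S x))" "prob_space M"
  shows "gaussian_density m S x > 0"
proof -
  have "det ((2 * pi) *\<^sub>R S) \<noteq> 0"
  proof
    assume "det ((2 * pi) *\<^sub>R S) = 0"
    then have "(\<lambda>x. ennreal (gaussian_density m S x)) = (\<lambda>_. 0)"
      by (simp add: gaussian_density_def)
    then show False
      using prob_space.distributed_imp_emeasure_nonzero[OF assms(2,1)] by (simp add: fun_eq_iff)
  qed
  then show ?thesis by (simp add: gaussian_density_def)
qed

lemma indep_gaussian_diagonal:
  fixes S :: "real ^ 'n ^ 'n" and X :: "'w \<Rightarrow> real ^ 'n"
  assumes M: "prob_space M"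
    and X: "distributed M lborel X (\<lambda>x. ennreal (gaussian_density m S x))"
    and indep: "prob_space.indep_vars M (\<lambda>_. borel) (\<lambda>i \<omega>. X \<omega> $ i) UNIV"
    and S: "pos_def_matrix S"
  shows "diagonal_matrix S" "matrix_inv S $ i $ j = (if i = j then 1 / S $ i $ i else 0)"
proof -
  let ?K = "matrix_inv S"
  let ?Q = "\<lambda>v. v \<bullet> (?K *v v)"
  have cont: "continuous_on UNIV (gaussian_density m S)"
    unfolding gaussian_density_def[abs_def]
    by (intro continuous_intros bounded_linear.continuous_on[OF matrix_vector_mul_bounded_linear])
  have K0: "?K $ i $ j = 0" if "i \<noteq> j" for i j
  proof -
    let ?e = "\<lambda>i. axis i 1 :: real ^ 'n"
    define C where "C = det ((2 * pi) *\<^sub>R S) powr (- 1 / 2)"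
    have p: "gaussian_density m S (m + v) = C * exp (- 1 / 2 * ?Q v)" for v
      by (simp add: gaussian_density_def C_def)
    have "C \<noteq> 0" using gaussian_density_pos[OF X M, of "m + 0"] unfolding p by auto
    \<comment> \<open>Coordinate \<open>i\<close> is swapped and all others are kept. The point
      \<open>m\<close> appears as \<open>m + 0\<close> so that \<open>p\<close> rewrites it.\<close>
    have "gaussian_density m S (m + ?e i) * gaussian_density m S (m + ?e j)
        = gaussian_density m S (m + 0) * gaussian_density m S (m + (?e i + ?e j))"
    proof (rule indep_density_exchange[OF M X indep cont])
      show "0 \<le> gaussian_density m S x" for x using gaussian_density_pos[OF X M, of x] by simp
    qed (use that in \<open>auto simp: axis_def\<close>)
    then have "C * C * exp (- 1 / 2 * ?Q (?e i) + - 1 / 2 * ?Q (?e j))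
        = C * C * exp (- 1 / 2 * ?Q 0 + - 1 / 2 * ?Q (?e i + ?e j))"
      unfolding p exp_add by (simp add: mult_ac)
    then have "?Q (?e i) + ?Q (?e j) = ?Q 0 + ?Q (?e i + ?e j)"
      using \<open>C \<noteq> 0\<close> by simp
    \<comment> \<open>Expanding the quadratic form at \<open>?e i + ?e j\<close> leaves only the two
      cross terms, which are equal by symmetry.\<close>
    then have "?K $ i $ j + ?K $ j $ i = 0"
      by (simp add: inner_add_left inner_add_right matrix_vector_right_distrib
          inner_axis' matrix_vector_mult_basis column_def)
    moreover have "?K $ i $ j = ?K $ j $ i"
      using arg_cong[OF transpose_matrix_inv[OF S], of "\<lambda>K. K $ j $ i"] by (simp add: transpose_def)
    ultimately show ?thesis by simp
  qed
  have SK: "S $ i $ j * ?K $ j $ j = (if i = j then 1 else 0)" for i j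
  proof -
    have "(S ** ?K) $ i $ j = (\<Sum>k\<in>UNIV. S $ i $ k * ?K $ k $ j)"
      by (simp add: matrix_matrix_mult_def)
    also have "\<dots> = (\<Sum>k\<in>UNIV. if k = j then S $ i $ k * ?K $ k $ j else 0)"
      by (intro sum.cong) (auto simp: K0)
    finally show ?thesis by (simp add: pos_def_matrix_inv[OF S] mat_def)
  qed
  \<comment> \<open>The case \<open>i = j\<close> of \<open>SK\<close> gives
    \<open>?K $ j $ j \<noteq> 0\<close>, so the other case forces
    \<open>S $ i $ j = 0\<close>.\<close>
  show "diagonal_matrix S"
    unfolding diagonal_matrix_def using SK by (metis mult_eq_0_iff zero_neq_one)
  show "?K $ i $ j = (if i = j then 1 / S $ i $ i else 0)"
    using K0[of i j] SK[of i i] pos_def_matrix_diag_pos[OF S, of i] by (auto simp: field_simps)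
qed

section \<open>Products of normal densities\<close>

text \<open>This is Fubini for a product of functions of single coordinates. \<open>lborel\<close>
  on vectors is an image of the product measure indexed by \<open>Basis\<close>, so the factors must
  be reindexed from coordinates to basis vectors.\<close>

lemma has_bochner_integral_lborel_vec_prod:
  fixes f :: "'n::finite \<Rightarrow> real \<Rightarrow> real"
  assumes f: "\<And>i. integrable lborel (f i)"
  shows "has_bochner_integral lborel (\<lambda>x :: real ^ 'n. \<Prod>i\<in>UNIV. f i (x $ i)) (\<Prod>i\<in>UNIV. LINT y|lborel. f i y)"
proof -
  let ?e = "\<lambda>i. axis i 1 :: real ^ 'n"
  let ?L = "\<lambda>h. \<Sum>b\<in>Basis. h b *\<^sub>R b :: real ^ 'n"
  have bij: "bij_betw ?e UNIV Basis"
    by (auto simp: bij_betw_def inj_on_def axis_eq_axis Basis_vec_def)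
  \<comment> \<open>\<open>idx\<close> recovers the coordinate of a basis vector, which tells which
    factor belongs to it.\<close>
  define idx where "idx = inv_into UNIV ?e"
  have idx: "idx (?e i) = i" for i
    unfolding idx_def by (rule inv_into_f_f) (use bij in \<open>auto simp: bij_betw_def\<close>)
  have reindex: "(\<Prod>b\<in>Basis. g (idx b) b) = (\<Prod>i\<in>UNIV. g i (?e i))" for g :: "'n \<Rightarrow> _ \<Rightarrow> real"
    using prod.reindex_bij_betw[OF bij, of "\<lambda>b. g (idx b) b"] by (simp add: idx)
  have L: "?L h $ i = h (?e i)" for h i
  proof -
    have "?L h $ i = ?L h \<bullet> ?e i" by (simp add: inner_axis)
    then show ?thesis using bij by (simp add: inner_sum_left_Basis bij_betwE)
  qed
  have prod: "(\<Prod>i\<in>UNIV. f i (?L h $ i)) = (\<Prod>b\<in>Basis. f (idx b) (h b))" for h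
    unfolding L using reindex[of "\<lambda>i b. f i (h b)"] by simp
  interpret product_sigma_finite "\<lambda>_ :: real ^ 'n. lborel :: real measure"
    by standard
  have [measurable]: "f i \<in> borel_measurable borel" for i using f[of i] by auto
  have "integrable lborel (\<lambda>x :: real ^ 'n. \<Prod>i\<in>UNIV. f i (x $ i))"
    unfolding lborel_eq[where 'a="real ^ 'n"]
    by (subst integrable_distr_eq) (auto simp: prod[simplified] intro!: product_integrable_prod f)
  moreover have "(LINT x|lborel. (\<Prod>i\<in>UNIV. f i ((x :: real ^ 'n) $ i))) = (\<Prod>i\<in>UNIV. LINT y|lborel. f i y)"
    unfolding lborel_eq[where 'a="real ^ 'n"]
    by (subst integral_distr) (auto simp: prod[simplified] product_integral_prod[OF finite_Basis f] reindex[of "\<lambda>i b. LINT y|lborel. f i y"])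
  ultimately show ?thesis by (simp add: has_bochner_integral_iff)
qed

text \<open>The parameter \<open>v\<close> holds variances, the quantities that the covariance
  equation evolves; \<open>normal_density\<close> takes standard deviations.\<close>

definition prod_normal :: "real ^ 'n \<Rightarrow> ('n \<Rightarrow> real) \<Rightarrow> real ^ 'n \<Rightarrow> real" where
  "prod_normal m v x = (\<Prod>i\<in>UNIV. normal_density (m $ i) (sqrt (v i)) (x $ i))"

lemma prod_normal_remove:
  "prod_normal m v x = normal_density (m $ i) (sqrt (v i)) (x $ i)
     * (\<Prod>j\<in>UNIV - {i}. normal_density (m $ j) (sqrt (v j)) (x $ j))"
  unfolding prod_normal_def by (rule prod.remove) auto

lemma prod_normal_pos: "(\<And>i. v i > 0) \<Longrightarrow> prod_normal m v x > 0"
  unfolding prod_normal_def by (intro prod_pos) (auto intro: normal_density_pos)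

text \<open>The determinant is a product over the coordinates and the quadratic form a sum, so both
  the prefactor and the exponential split into one factor per coordinate.\<close>

lemma gaussian_density_diagonal:
  fixes S :: "real ^ 'n ^ 'n"
  assumes "\<And>i. S $ i $ i > 0" "diagonal_matrix S"
    and inv: "\<And>i j. matrix_inv S $ i $ j = (if i = j then 1 / S $ i $ i else 0)"
  shows "gaussian_density m S x = prod_normal m (\<lambda>i. S $ i $ i) x"
proof -
  have "det ((2 * pi) *\<^sub>R S) = (\<Prod>i\<in>UNIV. 2 * pi * S $ i $ i)"
    using assms(2) by (subst det_diagonal) (auto simp: diagonal_matrix_def)
  then have det: "det ((2 * pi) *\<^sub>R S) powr (- 1 / 2) = (\<Prod>i\<in>UNIV. (2 * pi * S $ i $ i) powr (- 1 / 2))"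
    using assms(1) by (simp add: prod_powr_distrib less_imp_le)
  have factor: "(2 * pi * S $ i $ i) powr (- 1 / 2) = 1 / sqrt (2 * pi * (sqrt (S $ i $ i))\<^sup>2)" for i
  proof -
    have "(2 * pi * S $ i $ i) powr (- (1 / 2)) = inverse (sqrt (2 * pi * S $ i $ i))"
      unfolding powr_minus using assms(1)[of i] by (subst powr_half_sqrt) auto
    then show ?thesis using assms(1)[of i] by (simp add: inverse_eq_divide less_imp_le)
  qed
  have "(x - m) \<bullet> (matrix_inv S *v (x - m)) = (\<Sum>i\<in>UNIV. (x $ i - m $ i)\<^sup>2 / S $ i $ i)"
  proof -
    have "(matrix_inv S *v (x - m)) $ i = (x $ i - m $ i) / S $ i $ i" for i
      unfolding matrix_vector_mult_def
      by (simp add: inv if_distrib[of "\<lambda>u. u * _"] cong: if_cong)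
    then show ?thesis by (simp add: inner_vec_def power2_eq_square)
  qed
  then have "exp (- 1 / 2 * ((x - m) \<bullet> (matrix_inv S *v (x - m))))
      = (\<Prod>i\<in>UNIV. exp (- (x $ i - m $ i)\<^sup>2 / (2 * (sqrt (S $ i $ i))\<^sup>2)))"
    using assms(1) by (simp add: exp_sum[symmetric] sum_distrib_left sum_negf less_imp_le)
  then show ?thesis
    unfolding gaussian_density_def det prod_normal_def normal_density_def factor
    by (simp only: prod.distrib)
qed

lemma partial_deriv_prod_normal:
  assumes v: "\<And>i. v i > 0"
  shows "partial_deriv i (prod_normal m v) x = - ((x $ i - m $ i) / v i) * prod_normal m v x"
proof -
  let ?R = "\<Prod>j\<in>UNIV - {i}. normal_density (m $ j) (sqrt (v j)) (x $ j)"
  have "prod_normal m v (x + h *\<^sub>R axis i 1) = normal_density (m $ i) (sqrt (v i)) (x $ i + h) * ?R" for h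
    unfolding prod_normal_remove[of m v _ i] by (auto simp: axis_def intro!: prod.cong)
  moreover have "((\<lambda>h. normal_density (m $ i) (sqrt (v i)) (x $ i + h) * ?R) has_real_derivative
      - ((x $ i - m $ i) / v i) * normal_density (m $ i) (sqrt (v i)) (x $ i) * ?R) (at 0)"
    unfolding normal_density_def
    by (rule derivative_eq_intros refl | use v[of i] in \<open>simp add: field_simps\<close>)+
  ultimately show ?thesis
    unfolding partial_deriv_def prod_normal_remove[of m v x i]
    by (simp add: DERIV_imp_deriv)
qed

lemma deriv_normal_density:
  assumes v: "v > 0"
  shows "deriv (normal_density m (sqrt v)) y = - ((y - m) / v) * normal_density m (sqrt v) y"
proof (rule DERIV_imp_deriv)
  show "(normal_density m (sqrt v) has_real_derivative - ((y - m) / v) * normal_density m (sqrt v) y) (at y)"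
    unfolding normal_density_def[abs_def]
    by (rule derivative_eq_intros refl | use v in \<open>simp add: field_simps\<close>)+
qed

text \<open>The remaining factors integrate to one; if there are none, the empty product does so
  too.\<close>

lemma prod_normal_marginal:
  fixes m :: "real ^ 'n"
  assumes v: "\<And>i. v i > 0"
  shows "(LINT z|Pi\<^sub>M (UNIV - {i}) (\<lambda>_. lborel). prod_normal m v (\<chi> j. if j = i then y else z j))
    = normal_density (m $ i) (sqrt (v i)) y"
proof -
  interpret product_sigma_finite "\<lambda>_ :: 'n. lborel :: real measure"
    by standard
  have "prod_normal m v (\<chi> j. if j = i then y else z j) = normal_density (m $ i) (sqrt (v i)) y
      * (\<Prod>j\<in>UNIV - {i}. normal_density (m $ j) (sqrt (v j)) (z j))" for z
    unfolding prod_normal_remove[of m v _ i] by (auto intro!: prod.cong)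
  moreover have "(LINT z|Pi\<^sub>M (UNIV - {i}) (\<lambda>_. lborel). (\<Prod>j\<in>UNIV - {i}. normal_density (m $ j) (sqrt (v j)) (z j))) = 1"
    using v by (subst product_integral_prod) auto
  ultimately show ?thesis by simp
qed

section \<open>Integration against products of normal densities\<close>

lemma prod_normal_integral_prod:
  fixes m :: "real ^ 'n"
  assumes "\<And>k. integrable lborel (\<lambda>y. normal_density (m $ k) (sqrt (v k)) y * w k y)"
  shows "has_bochner_integral lborel (\<lambda>x. prod_normal m v x * (\<Prod>k\<in>UNIV. w k (x $ k)))
    (\<Prod>k\<in>UNIV. LINT y|lborel. normal_density (m $ k) (sqrt (v k)) y * w k y)"
  using has_bochner_integral_lborel_vec_prod[OF assms] by (simp add: prod_normal_def prod.distrib)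

text \<open>The other coordinates get the weight 1, and their normal densities integrate to
  one.\<close>

lemma prod_normal_integral_component:
  fixes m :: "real ^ 'n"
  assumes v: "\<And>i. v i > 0"
    and w: "integrable lborel (\<lambda>y. normal_density (m $ i) (sqrt (v i)) y * w y)"
  shows "has_bochner_integral lborel (\<lambda>x. prod_normal m v x * w (x $ i))
    (LINT y|lborel. normal_density (m $ i) (sqrt (v i)) y * w y)"
proof -
  let ?w = "\<lambda>k. if k = i then w else (\<lambda>_. 1)"
  have 1: "(\<Prod>k\<in>UNIV. ?w k (x $ k)) = w (x $ i)" for x :: "real ^ 'n"
    by (subst prod.remove[of _ i]) auto
  have 2: "(\<Prod>k\<in>UNIV. LINT y|lborel. normal_density (m $ k) (sqrt (v k)) y * ?w k y)
      = (LINT y|lborel. normal_density (m $ i) (sqrt (v i)) y * w y)"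
    using v by (subst prod.remove[of _ i]) auto
  have "integrable lborel (\<lambda>y. normal_density (m $ k) (sqrt (v k)) y * ?w k y)" for k
    using v w by auto
  from prod_normal_integral_prod[OF this] show ?thesis unfolding 1 2 .
qed

lemma prod_normal_integral_two_components:
  fixes m :: "real ^ 'n"
  assumes v: "\<And>i. v i > 0" and "i \<noteq> j"
    and w: "integrable lborel (\<lambda>y. normal_density (m $ i) (sqrt (v i)) y * w y)"
    and w': "integrable lborel (\<lambda>y. normal_density (m $ j) (sqrt (v j)) y * w' y)"
  shows "has_bochner_integral lborel (\<lambda>x. prod_normal m v x * (w (x $ i) * w' (x $ j)))
    ((LINT y|lborel. normal_density (m $ i) (sqrt (v i)) y * w y)
     * (LINT y|lborel. normal_density (m $ j) (sqrt (v j)) y * w' y))"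
proof -
  let ?w = "\<lambda>k. if k = i then w else if k = j then w' else (\<lambda>_. 1)"
  have 1: "(\<Prod>k\<in>UNIV. ?w k (x $ k)) = w (x $ i) * w' (x $ j)" for x :: "real ^ 'n"
    using \<open>i \<noteq> j\<close> by (subst prod.remove[of _ i], simp, simp, subst prod.remove[of _ j]) auto
  have 2: "(\<Prod>k\<in>UNIV. LINT y|lborel. normal_density (m $ k) (sqrt (v k)) y * ?w k y)
      = (LINT y|lborel. normal_density (m $ i) (sqrt (v i)) y * w y)
        * (LINT y|lborel. normal_density (m $ j) (sqrt (v j)) y * w' y)"
    using v \<open>i \<noteq> j\<close> by (subst prod.remove[of _ i], simp, simp, subst prod.remove[of _ j]) auto
  have "integrable lborel (\<lambda>y. normal_density (m $ k) (sqrt (v k)) y * ?w k y)" for k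
    using v w w' by auto
  from prod_normal_integral_prod[OF this] show ?thesis unfolding 1 2 .
qed

text \<open>In the expanded square each cross term integrates to a product of two means, both zero,
  and only the squares remain.\<close>

lemma prod_normal_integral_square_sum:
  fixes m :: "real ^ 'n"
  assumes v: "\<And>i. v i > 0"
    and g: "\<And>i. integrable lborel (\<lambda>y. normal_density (m $ i) (sqrt (v i)) y * g i y)"
    and g0: "\<And>i. (LINT y|lborel. normal_density (m $ i) (sqrt (v i)) y * g i y) = 0"
    and g2: "\<And>i. integrable lborel (\<lambda>y. normal_density (m $ i) (sqrt (v i)) y * (g i y)\<^sup>2)"
  shows "(LINT x|lborel. prod_normal m v x * (\<Sum>i\<in>UNIV. g i (x $ i))\<^sup>2)
    = (\<Sum>i\<in>UNIV. LINT y|lborel. normal_density (m $ i) (sqrt (v i)) y * (g i y)\<^sup>2)"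
proof -
  let ?I = "\<lambda>i. LINT y|lborel. normal_density (m $ i) (sqrt (v i)) y * (g i y)\<^sup>2"
  have summand: "has_bochner_integral lborel (\<lambda>x. prod_normal m v x * (g i (x $ i) * g j (x $ j)))
      (if j = i then ?I i else 0)" for i j
  proof (cases "i = j")
    case True
    then show ?thesis
      using prod_normal_integral_component[where v = v, OF v g2[of i]] by (simp add: power2_eq_square)
  next
    case False
    then show ?thesis
      using prod_normal_integral_two_components[where v = v, OF v False g[of i] g[of j]] by (simp add: g0)
  qed
  have "has_bochner_integral lborel
      (\<lambda>x. \<Sum>i\<in>UNIV. \<Sum>j\<in>UNIV. prod_normal m v x * (g i (x $ i) * g j (x $ j)))
      (\<Sum>i\<in>UNIV. \<Sum>j\<in>UNIV. if j = i then ?I i else 0)"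
    by (intro has_bochner_integral_sum summand)
  moreover have "prod_normal m v x * (\<Sum>i\<in>UNIV. g i (x $ i))\<^sup>2
      = (\<Sum>i\<in>UNIV. \<Sum>j\<in>UNIV. prod_normal m v x * (g i (x $ i) * g j (x $ j)))" for x
    unfolding power2_eq_square sum_product by (simp add: sum_distrib_left)
  ultimately show ?thesis
    by (simp add: has_bochner_integral_iff)
qed

section \<open>Moments and time derivatives of the normal density\<close>

text \<open>Degree four is enough: the squared score and the score times the log-density are quartic
  in \<open>y - m\<close>. Odd central moments vanish, the second is \<open>v\<close> and the fourth
  is \<open>3 * v\<^sup>2\<close>.\<close>

lemma normal_quartic_moment:
  assumes v: "v > 0"
  shows "has_bochner_integral lborel (\<lambda>y. normal_density m (sqrt v) y
      * (c0 + c1 * (y - m) + c2 * (y - m)\<^sup>2 + c3 * (y - m) ^ 3 + c4 * (y - m) ^ 4))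
    (c0 + c2 * v + 3 * c4 * v\<^sup>2)"
proof -
  let ?\<phi> = "normal_density m (sqrt v)"
  have \<sigma>: "sqrt v > 0" using v by simp
  have 0: "has_bochner_integral lborel ?\<phi> 1"
    using normal_moment_even[OF \<sigma>, of m 0] by simp
  have 1: "has_bochner_integral lborel (\<lambda>y. ?\<phi> y * (y - m)) 0"
    using normal_moment_odd[OF \<sigma>, of m 0] by simp
  have 2: "has_bochner_integral lborel (\<lambda>y. ?\<phi> y * (y - m)\<^sup>2) v"
    using normal_moment_even[OF \<sigma>, of m 1] v by simp
  have 3: "has_bochner_integral lborel (\<lambda>y. ?\<phi> y * (y - m) ^ 3) 0"
    using normal_moment_odd[OF \<sigma>, of m 1] by simp
  have 4: "has_bochner_integral lborel (\<lambda>y. ?\<phi> y * (y - m) ^ 4) (3 * v\<^sup>2)"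
    using normal_moment_even[OF \<sigma>, of m 2] v
    by (simp add: fact_numeral power_divide power2_eq_square)
  have "has_bochner_integral lborel (\<lambda>y. c0 * ?\<phi> y + c1 * (?\<phi> y * (y - m)) + c2 * (?\<phi> y * (y - m)\<^sup>2)
      + c3 * (?\<phi> y * (y - m) ^ 3) + c4 * (?\<phi> y * (y - m) ^ 4))
      (c0 * 1 + c1 * 0 + c2 * v + c3 * 0 + c4 * (3 * v\<^sup>2))"
    by (intro has_bochner_integral_add has_bochner_integral_mult_right 0 1 2 3 4)
  then show ?thesis by (simp add: algebra_simps)
qed

text \<open>Serves the entropy production, where the affine function is the current velocity and
  \<open>d\<close> the diffusion coefficient.\<close>

lemma normal_affine_square_moment:
  assumes v: "v > 0"
  shows "has_bochner_integral lborel (\<lambda>y. normal_density m (sqrt v) y * ((k * (y - m) + c)\<^sup>2 / d))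
    ((k\<^sup>2 * v + c\<^sup>2) / d)"
proof -
  have "(k * z + c)\<^sup>2 / d = c\<^sup>2 / d + (2 * k * c / d) * z + (k\<^sup>2 / d) * z\<^sup>2" for z
    by (simp add: power2_sum power_mult_distrib add_divide_distrib mult_ac)
  then show ?thesis
    using normal_quartic_moment[OF v, of m "c\<^sup>2 / d" "2 * k * c / d" "k\<^sup>2 / d" 0 0]
    by (simp add: add_divide_distrib add.commute)
qed

lemma ln_normal_density:
  assumes "v > 0"
  shows "ln (normal_density m (sqrt v) y) = - ln (2 * pi * v) / 2 - (y - m)\<^sup>2 / (2 * v)"
  using assms by (simp add: normal_density_def ln_mult ln_div ln_sqrt field_simps)

text \<open>The rate of change of the log-density at \<open>y\<close> when mean and variance move
  with velocities \<open>m'\<close> and \<open>v'\<close>.\<close>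

definition normal_score :: "real \<Rightarrow> real \<Rightarrow> real \<Rightarrow> real \<Rightarrow> real \<Rightarrow> real" where
  "normal_score m v m' v' y = v' / (2 * v\<^sup>2) * ((y - m)\<^sup>2 - v) + m' / v * (y - m)"

lemma has_derivative_ln_normal_density:
  assumes m: "(m has_real_derivative m') (at t within T)"
    and v: "(v has_real_derivative v') (at t within T)"
    and pos: "\<And>s. s \<in> T \<Longrightarrow> v s > 0" and t: "t \<in> T"
  shows "((\<lambda>s. ln (normal_density (m s) (sqrt (v s)) y)) has_real_derivative
    normal_score (m t) (v t) m' v' y) (at t within T)"
proof -
  have "((\<lambda>s. - ln (2 * pi * v s) / 2 - (y - m s)\<^sup>2 / (2 * v s)) has_real_derivative
      normal_score (m t) (v t) m' v' y) (at t within T)"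
    unfolding normal_score_def
    by (rule derivative_eq_intros m v refl | use pos[OF t] in \<open>simp add: field_simps power2_eq_square\<close>)+
  \<comment> \<open>The closed form of the log-density holds wherever the variance is positive,
    hence on all of \<open>T\<close>, so any radius, here 1, transfers the derivative.\<close>
  then show ?thesis
    by (rule has_field_derivative_transform_within[OF _ zero_less_one t])
      (simp add: ln_normal_density pos)
qed

lemma has_derivative_normal_density_time:
  assumes m: "(m has_real_derivative m') (at t within T)"
    and v: "(v has_real_derivative v') (at t within T)"
    and pos: "\<And>s. s \<in> T \<Longrightarrow> v s > 0" and t: "t \<in> T"
  shows "((\<lambda>s. normal_density (m s) (sqrt (v s)) y) has_real_derivative
    normal_density (m t) (sqrt (v t)) y * normal_score (m t) (v t) m' v' y) (at t within T)"
proof -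
  have "((\<lambda>s. exp (ln (normal_density (m s) (sqrt (v s)) y))) has_real_derivative
      normal_density (m t) (sqrt (v t)) y * normal_score (m t) (v t) m' v' y) (at t within T)"
    using DERIV_chain2[OF DERIV_exp has_derivative_ln_normal_density[OF assms]] pos[OF t]
    by (simp add: normal_density_pos)
  then show ?thesis
    by (rule has_field_derivative_transform_within[OF _ zero_less_one t])
      (simp add: normal_density_pos pos)
qed

text \<open>These are the mean of the score, the Fisher information along the path, and minus the
  entropy rate. The entropy of a normal law depends on its variance alone, so \<open>m'\<close>
  drops out of the third.\<close>

lemma normal_score_moments:
  assumes v: "v > 0"
  shows "has_bochner_integral lborel (\<lambda>y. normal_density m (sqrt v) y * normal_score m v m' v' y) 0"
    and "has_bochner_integral lborel (\<lambda>y. normal_density m (sqrt v) y * (normal_score m v m' v' y)\<^sup>2)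
      (v'\<^sup>2 / (2 * v\<^sup>2) + m'\<^sup>2 / v)"
    and "has_bochner_integral lborel (\<lambda>y. normal_density m (sqrt v) y * normal_score m v m' v' y
        * ln (normal_density m (sqrt v) y)) (- v' / (2 * v))"
proof -
  let ?a = "v' / (2 * v\<^sup>2)" and ?b = "m' / v"
  have score: "normal_score m v m' v' y = - ?a * v + ?b * (y - m) + ?a * (y - m)\<^sup>2" for y
    by (simp add: normal_score_def right_diff_distrib)
  show "has_bochner_integral lborel (\<lambda>y. normal_density m (sqrt v) y * normal_score m v m' v' y) 0"
    using normal_quartic_moment[OF v, of m "- ?a * v" ?b ?a 0 0] unfolding score by simp
  have square: "(normal_score m v m' v' y)\<^sup>2 = ?a\<^sup>2 * v\<^sup>2 + (- 2 * ?a * v * ?b) * (y - m)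
      + (?b\<^sup>2 - 2 * ?a\<^sup>2 * v) * (y - m)\<^sup>2 + (2 * ?a * ?b) * (y - m) ^ 3 + ?a\<^sup>2 * (y - m) ^ 4" for y
    unfolding score by (simp only: power2_eq_square power3_eq_cube power4_eq_xxxx) algebra
  \<comment> \<open>The value of the quartic moment uses only the even coefficients of
    \<open>square\<close>.\<close>
  have "?a\<^sup>2 * v\<^sup>2 + (?b\<^sup>2 - 2 * ?a\<^sup>2 * v) * v + 3 * ?a\<^sup>2 * v\<^sup>2 = v'\<^sup>2 / (2 * v\<^sup>2) + m'\<^sup>2 / v"
    using v by (simp add: field_simps power2_eq_square)
  then show "has_bochner_integral lborel (\<lambda>y. normal_density m (sqrt v) y * (normal_score m v m' v' y)\<^sup>2)
      (v'\<^sup>2 / (2 * v\<^sup>2) + m'\<^sup>2 / v)"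
    using normal_quartic_moment[OF v, of m "?a\<^sup>2 * v\<^sup>2" "- 2 * ?a * v * ?b" "?b\<^sup>2 - 2 * ?a\<^sup>2 * v" "2 * ?a * ?b" "?a\<^sup>2"]
    unfolding square by simp
  let ?c = "- ln (2 * pi * v) / 2" and ?d = "1 / (2 * v)"
  have "normal_score m v m' v' y * ln (normal_density m (sqrt v) y)
      = - ?a * v * ?c + ?b * ?c * (y - m) + (?a * ?c + ?a * v * ?d) * (y - m)\<^sup>2
        + (- ?b * ?d) * (y - m) ^ 3 + (- ?a * ?d) * (y - m) ^ 4" for y
  proof -
    have ln: "ln (normal_density m (sqrt v) y) = ?c - ?d * (y - m)\<^sup>2"
      using ln_normal_density[OF v, of m y] by simp
    show ?thesis
      unfolding score ln by (simp only: power2_eq_square power3_eq_cube power4_eq_xxxx) algebra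
  qed
  moreover have "- ?a * v * ?c + (?a * ?c + ?a * v * ?d) * v + 3 * (- ?a * ?d) * v\<^sup>2 = - v' / (2 * v)"
    using v by (simp add: field_simps power2_eq_square)
  ultimately show "has_bochner_integral lborel (\<lambda>y. normal_density m (sqrt v) y * normal_score m v m' v' y
        * ln (normal_density m (sqrt v) y)) (- v' / (2 * v))"
    using normal_quartic_moment[OF v, of m "- ?a * v * ?c" "?b * ?c" "?a * ?c + ?a * v * ?d" "- ?b * ?d" "- ?a * ?d"]
    by (simp only: mult.assoc)
qed

text \<open>A connected set with more than one point has no isolated points. This makes derivatives
  within \<open>T\<close> unique, so that the choice behind \<open>time_deriv\<close> returns the
  expected value.\<close>

lemma at_within_interval_neq_bot:
  fixes T :: "real set"
  assumes "is_interval T" "\<exists>a\<in>T. \<exists>b\<in>T. a < b" "t \<in> T"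
  shows "at t within T \<noteq> bot"
proof -
  have "t islimpt T"
    using assms by (intro connected_imp_perfect) (auto simp: is_interval_connected_1)
  then show ?thesis by (simp add: trivial_limit_within)
qed

lemma time_deriv_eq:
  assumes "at t within T \<noteq> bot" "(f has_real_derivative f') (at t within T)"
  shows "time_deriv T f t = f'"
  unfolding time_deriv_def using assms
  by (intro vector_derivative_within) (simp_all add: has_real_derivative_iff_has_vector_derivative)

lemma ln_prod_normal:
  assumes "\<And>i. v i > 0"
  shows "ln (prod_normal m v x) = (\<Sum>i\<in>UNIV. ln (normal_density (m $ i) (sqrt (v i)) (x $ i)))"
  unfolding prod_normal_def using assms by (subst ln_prod) (auto simp: normal_density_pos less_imp_neq[symmetric])

section \<open>Information rate and entropy\<close>

theorem mainTheorem4: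
  fixes T :: "real set"
    and A :: "real ^ 'n ^ 'n" and B :: "real ^ 'm ^ 'n"
    and u :: "real \<Rightarrow> real ^ 'm"
    and D :: "real \<Rightarrow> real ^ 'n ^ 'n"
    and \<mu> :: "real \<Rightarrow> real ^ 'n" and \<Sigma> :: "real \<Rightarrow> real ^ 'n ^ 'n"
    and p :: "real ^ 'n \<Rightarrow> real \<Rightarrow> real"
    and M :: "'w measure" and X :: "real \<Rightarrow> 'w \<Rightarrow> real ^ 'n"
    and t :: real
  assumes T: "is_interval T" "\<exists>a\<in>T. \<exists>b\<in>T. a < b"
    and u: "continuous_on T u"
    and D: "\<And>s. s \<in> T \<Longrightarrow> diagonal_matrix (D s)" "\<And>s i. s \<in> T \<Longrightarrow> D s $ i $ i > 0"
    and \<Sigma>_pos_def: "\<And>s. s \<in> T \<Longrightarrow> pos_def_matrix (\<Sigma> s)"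
    and p: "\<And>s x. s \<in> T \<Longrightarrow> p x s = gaussian_density (\<mu> s) (\<Sigma> s) x"
    and \<mu>_ode: "\<And>s. s \<in> T \<Longrightarrow>
      (\<mu> has_vector_derivative (A *v \<mu> s + B *v u s)) (at s within T)"
    and \<Sigma>_ode: "\<And>s. s \<in> T \<Longrightarrow>
      (\<Sigma> has_vector_derivative (A ** \<Sigma> s + \<Sigma> s ** transpose A + 2 *\<^sub>R D s)) (at s within T)"
    and A: "diagonal_matrix A"
    and M: "prob_space M"
    and X: "\<And>s. s \<in> T \<Longrightarrow> distributed M lborel (X s) (\<lambda>x. ennreal (p x s))"
    and indep: "\<And>s. s \<in> T \<Longrightarrow>
      prob_space.indep_vars M (\<lambda>_. borel) (\<lambda>i \<omega>. X s \<omega> $ i) UNIV"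
    and t: "t \<in> T"
  shows "(information_rate T p t)\<^sup>2 =
           (\<Sum>i\<in>UNIV. D t $ i $ i / \<Sigma> t $ i $ i * entropy_production A B u D p i t)
           + (\<Sum>i\<in>UNIV. (marginal_entropy_rate T p i t)\<^sup>2)
         \<and> (\<forall>i. entropy_production A B u D p i t = marginal_entropy_production A B u D p i t)"
proof -
  have X_gaussian: "distributed M lborel (X s) (\<lambda>x. ennreal (gaussian_density (\<mu> s) (\<Sigma> s) x))" if "s \<in> T" for s
    using X[OF that] by (simp add: p that)
  note diag = indep_gaussian_diagonal[OF M X_gaussian indep \<Sigma>_pos_def]
  have \<Sigma>_pos: "\<Sigma> s $ i $ i > 0" if "s \<in> T" for s i
    by (rule pos_def_matrix_diag_pos[OF \<Sigma>_pos_def[OF that]])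
  have p_prod: "p x s = prod_normal (\<mu> s) (\<lambda>i. \<Sigma> s $ i $ i) x" if "s \<in> T" for s x
    unfolding p[OF that] by (rule gaussian_density_diagonal) (use that in \<open>auto simp: \<Sigma>_pos diag\<close>)
  define m where "m = \<mu> t"
  define v where "v i = \<Sigma> t $ i $ i" for i
  define d where "d i = D t $ i $ i" for i
  \<comment> \<open>For diagonal \<open>A\<close> the mean and variance equations decouple;
    \<open>m'\<close> and \<open>v'\<close> are their right-hand sides in coordinate
    \<open>i\<close>.\<close>
  define m' where "m' i = A $ i $ i * m $ i + (B *v u t) $ i" for i
  define v' where "v' i = 2 * A $ i $ i * v i + 2 * d i" for i
  let ?g = "\<lambda>i. normal_score (m $ i) (v i) (m' i) (v' i)"
  let ?\<phi> = "\<lambda>i. normal_density (m $ i) (sqrt (v i))"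
  have v: "v i > 0" for i unfolding v_def by (rule \<Sigma>_pos[OF t])
  have d: "d i > 0" for i unfolding d_def by (rule D(2)[OF t])
  have p_t: "p x t = prod_normal m v x" for x
    using p_prod[OF t] by (simp add: m_def v_def[abs_def])
  have A_vec: "(A *v x) $ i = A $ i $ i * x $ i" for x i
    by (simp add: matrix_vector_mult_def diagonal_matrix_row_sum[OF A])
  have A_\<Sigma>: "(A ** \<Sigma> t) $ i $ i = A $ i $ i * v i" "(\<Sigma> t ** transpose A) $ i $ i = A $ i $ i * v i" for i
    by (simp_all add: matrix_matrix_mult_def transpose_def diagonal_matrix_row_sum[OF A] v_def
        mult.commute[of "\<Sigma> t $ _ $ _"])
  have D\<mu>: "((\<lambda>s. \<mu> s $ i) has_real_derivative m' i) (at t within T)" for i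
    using bounded_linear.has_vector_derivative[OF bounded_linear_vec_nth \<mu>_ode[OF t], of i]
    by (simp add: has_real_derivative_iff_has_vector_derivative A_vec m'_def m_def)
  have D\<Sigma>: "((\<lambda>s. \<Sigma> s $ i $ i) has_real_derivative v' i) (at t within T)" for i
    using bounded_linear.has_vector_derivative[OF bounded_linear_vec_nth
        bounded_linear.has_vector_derivative[OF bounded_linear_vec_nth \<Sigma>_ode[OF t], of i], of i]
    by (simp add: has_real_derivative_iff_has_vector_derivative A_\<Sigma> v'_def d_def mult_ac)
  note not_bot = at_within_interval_neq_bot[OF T t]
  note moments = normal_score_moments[OF v]

  have "time_deriv T (\<lambda>s. ln (p x s)) t = (\<Sum>i\<in>UNIV. ?g i (x $ i))" for x
  proof (rule time_deriv_eq[OF not_bot])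
    have "((\<lambda>s. \<Sum>i\<in>UNIV. ln (normal_density (\<mu> s $ i) (sqrt (\<Sigma> s $ i $ i)) (x $ i)))
        has_real_derivative (\<Sum>i\<in>UNIV. ?g i (x $ i))) (at t within T)"
      unfolding m_def v_def
      by (intro DERIV_sum has_derivative_ln_normal_density D\<mu>[unfolded m_def v_def] D\<Sigma>[unfolded v_def] \<Sigma>_pos t)
    then show "((\<lambda>s. ln (p x s)) has_real_derivative (\<Sum>i\<in>UNIV. ?g i (x $ i))) (at t within T)"
      by (rule has_field_derivative_transform_within[OF _ zero_less_one t])
        (simp add: p_prod ln_prod_normal \<Sigma>_pos)
  qed
  then have "(LINT x|lborel. p x t * (time_deriv T (\<lambda>s. ln (p x s)) t)\<^sup>2)
      = (LINT x|lborel. prod_normal m v x * (\<Sum>i\<in>UNIV. ?g i (x $ i))\<^sup>2)"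
    by (simp add: p_t)
  also have "\<dots> = (\<Sum>i\<in>UNIV. LINT y|lborel. ?\<phi> i y * (?g i y)\<^sup>2)"
    by (rule prod_normal_integral_square_sum[OF v])
      (rule moments(1,2)[THEN integrable.intros] moments(1)[THEN has_bochner_integral_integral_eq])+
  also have "\<dots> = (\<Sum>i\<in>UNIV. (v' i)\<^sup>2 / (2 * (v i)\<^sup>2) + (m' i)\<^sup>2 / v i)"
    by (simp only: moments(2)[THEN has_bochner_integral_integral_eq])
  finally have "(LINT x|lborel. p x t * (time_deriv T (\<lambda>s. ln (p x s)) t)\<^sup>2)
      = (\<Sum>i\<in>UNIV. (v' i)\<^sup>2 / (2 * (v i)\<^sup>2) + (m' i)\<^sup>2 / v i)" .
  \<comment> \<open>Nonnegativity lets the square undo the root in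
    \<open>information_rate\<close>.\<close>
  moreover have "(LINT x|lborel. p x t * (time_deriv T (\<lambda>s. ln (p x s)) t)\<^sup>2) \<ge> 0"
    by (intro integral_nonneg_AE) (simp add: p_t prod_normal_pos v less_imp_le)
  ultimately have rate: "(information_rate T p t)\<^sup>2
      = (\<Sum>i\<in>UNIV. (v' i)\<^sup>2 / (2 * (v i)\<^sup>2) + (m' i)\<^sup>2 / v i)"
    unfolding information_rate_def by simp

  \<comment> \<open>Stated for all times in \<open>T\<close>, because the marginal is differentiated
    in time next.\<close>
  have marginal: "marginal_density p i y s = normal_density (\<mu> s $ i) (sqrt (\<Sigma> s $ i $ i)) y" if "s \<in> T" for i y s
    unfolding marginal_density_def p_prod[OF that] by (rule prod_normal_marginal) (rule \<Sigma>_pos[OF that])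
  have marginal_t: "(\<lambda>y. marginal_density p i y t) = ?\<phi> i" for i
    by (simp add: marginal[OF t] m_def v_def fun_eq_iff)
  have "time_deriv T (marginal_density p i y) t = ?\<phi> i y * ?g i y" for i y
  proof (rule time_deriv_eq[OF not_bot])
    show "(marginal_density p i y has_real_derivative ?\<phi> i y * ?g i y) (at t within T)"
      unfolding m_def v_def
      by (rule has_field_derivative_transform_within[OF
            has_derivative_normal_density_time[OF D\<mu>[unfolded m_def v_def] D\<Sigma>[unfolded v_def] \<Sigma>_pos t]
            zero_less_one t])
        (simp_all add: marginal)
  qed
  then have entropy: "marginal_entropy_rate T p i t = v' i / (2 * v i)" for i
    unfolding marginal_entropy_rate_def fun_cong[OF marginal_t] using moments(3)
    by (simp add: has_bochner_integral_iff)

  \<comment> \<open>The current velocity \<open>J\<^sub>i / p\<close> is affine in \<open>x\<^sub>i\<close>, with slope \<open>A\<^sub>i\<^sub>i + D\<^sub>i\<^sub>i / \<Sigma>\<^sub>i\<^sub>i = v'\<^sub>i / (2 v\<^sub>i)\<close>.\<close>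
  let ?w = "\<lambda>i y. v' i / (2 * v i) * (y - m $ i) + m' i"
  have velocity: "A $ i $ i * y + (B *v u t) $ i + d i * ((y - m $ i) / v i) = ?w i y" for i y
    using v[of i] by (simp add: v'_def m'_def field_simps)
  \<comment> \<open>Both the joint and the marginal entropy production reduce to this
    one-dimensional integral, which gives their equality.\<close>
  have w_moment: "has_bochner_integral lborel (\<lambda>y. ?\<phi> i y * ((?w i y)\<^sup>2 / d i))
      (((v' i)\<^sup>2 / (4 * v i) + (m' i)\<^sup>2) / d i)" for i
  proof -
    have "((v' i / (2 * v i))\<^sup>2 * v i + (m' i)\<^sup>2) / d i = ((v' i)\<^sup>2 / (4 * v i) + (m' i)\<^sup>2) / d i"
      using v[of i] by (simp add: power2_eq_square)
    then show ?thesis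
      using normal_affine_square_moment[OF v, of "m $ i" i "v' i / (2 * v i)" "m' i" "d i"] by (simp only:)
  qed
  have current: "prob_current A B u D p i x t = prod_normal m v x * ?w i (x $ i)" for i x
  proof -
    have "(\<Sum>j\<in>UNIV. D t $ i $ j * partial_deriv j (prod_normal m v) x)
        = - (d i * ((x $ i - m $ i) / v i)) * prod_normal m v x"
      unfolding diagonal_matrix_row_sum[OF D(1)[OF t]] by (simp add: partial_deriv_prod_normal v d_def)
    then show ?thesis
      unfolding prob_current_def drift_def p_t velocity[symmetric]
      by (simp add: A_vec algebra_simps)
  qed
  have production: "entropy_production A B u D p i t = ((v' i)\<^sup>2 / (4 * v i) + (m' i)\<^sup>2) / d i" for i
  proof -
    have "(prob_current A B u D p i x t)\<^sup>2 / (D t $ i $ i * p x t)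
        = prod_normal m v x * ((?w i (x $ i))\<^sup>2 / d i)" for x
      unfolding current p_t d_def[symmetric]
      using prod_normal_pos[of v m x] v by (simp add: power2_eq_square)
    moreover have "(LINT x|lborel. prod_normal m v x * ((?w i (x $ i))\<^sup>2 / d i))
        = (LINT y|lborel. ?\<phi> i y * ((?w i y)\<^sup>2 / d i))"
      using prod_normal_integral_component[where v = v and i = i and w = "\<lambda>y. (?w i y)\<^sup>2 / d i", OF v] w_moment
      by (simp add: has_bochner_integral_iff)
    ultimately show ?thesis
      unfolding entropy_production_def by (simp only: has_bochner_integral_integral_eq[OF w_moment])
  qed
  have marginal_production: "marginal_entropy_production A B u D p i t
      = ((v' i)\<^sup>2 / (4 * v i) + (m' i)\<^sup>2) / d i" for i
  proof -
    have "marginal_current A B u D p i y t = ?\<phi> i y * ?w i y" for y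
      unfolding marginal_current_def marginal_t fun_cong[OF marginal_t] deriv_normal_density[OF v]
        d_def[symmetric] velocity[symmetric]
      by (simp add: algebra_simps)
    then have "(marginal_current A B u D p i y t)\<^sup>2 / (D t $ i $ i * marginal_density p i y t)
        = ?\<phi> i y * ((?w i y)\<^sup>2 / d i)" for y
      unfolding fun_cong[OF marginal_t] d_def[symmetric]
      using normal_density_pos[of "sqrt (v i)" "m $ i" y] v[of i] by (simp add: power2_eq_square)
    then show ?thesis
      unfolding marginal_entropy_production_def by (simp only: has_bochner_integral_integral_eq[OF w_moment])
  qed

  \<comment> \<open>The variance part of the information rate splits into two equal halves, one from
    the weighted entropy production and one from the squared entropy rate; the mean part comes from
    the production alone.\<close>
  have "(v' i)\<^sup>2 / (2 * (v i)\<^sup>2) + (m' i)\<^sup>2 / v i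
      = d i / v i * (((v' i)\<^sup>2 / (4 * v i) + (m' i)\<^sup>2) / d i) + (v' i / (2 * v i))\<^sup>2" for i
    using v[of i] d[of i] by (simp add: field_simps power2_eq_square)
  then show ?thesis
    unfolding rate entropy production marginal_production d_def[symmetric] v_def[symmetric]
    by (simp add: sum.distrib[symmetric])
qed

end
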